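(* Let $\mathcal{R}$ be a rectangle. There exists an integer $n_0=n_0(\mathcal{R})$, depending only on $\mathcal{R}$, such that for every positive integer $r$ and every $n\ge n_0$, $\mathbb{E}^{n} \overset{r}{\rightarrow} (\mathcal{R}; \mathcal{R})_{\mathrm{GR}}$; that is, every coloring $\chi:\mathbb{E}^n\to\{1,\dots,r\}$ contains a monochromatic congruent copy of $\mathcal{R}$ or a rainbow congruent copy of $\mathcal{R}$.
   Context: $\mathbb{E}^n$ denotes $n$-dimensional Euclidean space. A rectangle is identified with its set of four vertices (with positive side lengths). A congruent copy of a finite point set is its image under a distance-preserving map. A copy is monochromatic if all its points have the same color, and rainbow if its points have pairwise distinct colors. For configurations $\mathcal{K}_1,\mathcal{K}_2$, the notation $\mathbb{E}^n \overset{r}{\rightarrow} (\mathcal{K}_1;\mathcal{K}_2)_{\mathrm{GR}}$ means that every coloring $\chi:\mathbb{E}^n\to[r]$ yields a monochromatic congruent copy of $\mathcal{K}_1$ or a rainbow congruent copy of $\mathcal{K}_2$. *)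

theory Defs
  imports "HOL-Analysis.Analysis"
begin

text \<open>
  The dimension \<open>n\<close> of the coloured space is quantified inside the statement, so \<open>n\<close>-dimensional
  Euclidean space is the carrier \<open>topspace (Euclidean_space n)\<close> of the library, i.e. the sequences
  \<open>x :: nat \<Rightarrow> real\<close> with \<open>x i = 0\<close> for all \<open>i \<ge> n\<close>, with the distance \<open>edist n\<close> below.
\<close>

abbreviation euclidean_points :: "nat \<Rightarrow> (nat \<Rightarrow> real) set" where
  "euclidean_points n \<equiv> topspace (Euclidean_space n)"

definition edist :: "nat \<Rightarrow> (nat \<Rightarrow> real) \<Rightarrow> (nat \<Rightarrow> real) \<Rightarrow> real" where
  "edist n x y = L2_set (\<lambda>i. x i - y i) {..<n}"

definition is_rectangle :: "'a::euclidean_space set \<Rightarrow> bool" where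
  "is_rectangle R \<longleftrightarrow>
     (\<exists>p u v. u \<noteq> 0 \<and> v \<noteq> 0 \<and> u \<bullet> v = 0 \<and> R = {p, p + u, p + u + v, p + v})"

text \<open>
  The distance-preserving map is only required on the configuration \<open>K\<close> itself, since the Euclidean
  space containing \<open>K\<close> need not be the coloured one.
\<close>

definition congruent_copy :: "nat \<Rightarrow> 'a::euclidean_space set \<Rightarrow> (nat \<Rightarrow> real) set \<Rightarrow> bool" where
  "congruent_copy n K S \<longleftrightarrow>
     (\<exists>f. f ` K = S \<and> S \<subseteq> euclidean_points n \<and>
          (\<forall>x\<in>K. \<forall>y\<in>K. edist n (f x) (f y) = dist x y))"

definition monochromatic :: "('p \<Rightarrow> 'c) \<Rightarrow> 'p set \<Rightarrow> bool" where
  "monochromatic col S \<longleftrightarrow> (\<forall>x\<in>S. \<forall>y\<in>S. col x = col y)"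

definition rainbow :: "('p \<Rightarrow> 'c) \<Rightarrow> 'p set \<Rightarrow> bool" where
  "rainbow col S \<longleftrightarrow> (\<forall>x\<in>S. \<forall>y\<in>S. x \<noteq> y \<longrightarrow> col x \<noteq> col y)"

definition gallai_ramsey ::
  "nat \<Rightarrow> nat \<Rightarrow> 'a::euclidean_space set \<Rightarrow> 'b::euclidean_space set \<Rightarrow> bool" where
  "gallai_ramsey n r K1 K2 \<longleftrightarrow>
     (\<forall>col :: (nat \<Rightarrow> real) \<Rightarrow> nat. col \<in> euclidean_points n \<rightarrow> {1..r} \<longrightarrow>
        (\<exists>S. congruent_copy n K1 S \<and> monochromatic col S) \<or>
        (\<exists>S. congruent_copy n K2 S \<and> rainbow col S))"

end

theory Submission
  imports "HOL-Library.Ramsey" Defs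
begin

text \<open>
  The difficulty is that the dimension may not depend on the number of colours, so no Ramsey theorem
  can be applied to the colouring itself. It is applied instead to the pattern of coincidences of
  colours inside a combinatorial cube, of which there are only finitely many.

  Fix weights \<open>w i \<ge> 0\<close> for \<open>i < k\<close>, and to distinct indices \<open>x i\<close> assign the point that has the
  coordinate \<open>w i\<close> on the axis \<open>x i\<close> for every \<open>i < k\<close>, and \<open>0\<close> on all other axes. If every
  \<open>x i\<close> may take two values, and all these \<open>2k\<close> values are distinct, then the resulting \<open>2\<^sup>k\<close> points
  correspond to the subsets of \<open>{..<k}\<close>, and the squared distance of the points of \<open>A\<close> and \<open>B\<close> is the
  sum of \<open>q i = 2 * (w i)\<^sup>2\<close> over the symmetric difference of \<open>A\<close> and \<open>B\<close>. Hence for disjoint \<open>U\<close> and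
  \<open>V\<close> the points of \<open>{}\<close>, \<open>U\<close>, \<open>U \<union> V\<close>, \<open>V\<close> form a rectangle whose squared sides are the sums of
  \<open>q\<close> over \<open>U\<close> and over \<open>V\<close>.

  By \<open>canonical_cube\<close>, in the manner of the canonical theorem of Erdos and Rado, some cube has a
  set \<open>I\<close> of relevant coordinates: two of its points have the same colour exactly if
  they agree on \<open>I\<close>. The rectangle is then monochromatic if \<open>U\<close> and \<open>V\<close> both avoid
  \<open>I\<close>, and rainbow if they both meet \<open>I\<close>, since then the four sets have distinct traces on \<open>I\<close>.

  It remains to exclude that whenever \<open>U\<close> and \<open>V\<close> have the right sums, exactly one of them meets
  \<open>I\<close>. Lemma \<open>universal_weights\<close> does so by a list of values \<open>q i\<close> in which the longer side can be
  assembled from equal small pieces and single pieces of either side have their complements in the list: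
  either enough irrelevant pieces exist for both sides, or two equal relevant pieces can be
  distributed to the two sides.
\<close>

section \<open>Canonical colourings of a cube\<close>

lemma sorted_list_of_strict_mono_image:
  fixes t :: "nat \<Rightarrow> 'a::linorder"
  assumes "strict_mono_on {..<n} t"
  shows "sorted_list_of_set (t ` {..<n}) = map t [0..<n]"
proof -
  have "sorted_wrt (<) (map t [0..<n])"
    using assms by (auto simp: sorted_wrt_iff_nth_less intro: strict_mono_onD)
  then have "sorted (map t [0..<n])" "distinct (map t [0..<n])"
    by (simp_all add: strict_sorted_iff)
  moreover have "set (map t [0..<n]) = t ` {..<n}"
    by (simp add: lessThan_atLeast0)
  ultimately show ?thesis
    by (metis sorted_list_of_set.idem_if_sorted_distinct)
qed

text \<open>
  The finite Ramsey theorem with the colours taken from any finite set, since below they are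
  relations between sets.
\<close>

lemma Ramsey_finite_colour_type:
  fixes P :: "'p set"
  assumes "finite P"
  shows "\<exists>N::nat. \<forall>f :: nat set \<Rightarrow> 'p. range f \<subseteq> P \<longrightarrow>
           (\<exists>H c. H \<subseteq> {..<N} \<and> card H = m \<and> (\<forall>S\<subseteq>H. card S = r \<and> finite S \<longrightarrow> f S = c))"
proof -
  obtain g :: "'p \<Rightarrow> nat" where g: "bij_betw g P {..<card P}"
    using assms ex_bij_betw_finite_nat[of P] by (auto simp: lessThan_atLeast0)
  obtain N :: nat where N: "partn_lst {..<N} (replicate (card P) m) r"
    using ramsey_full by blast
  show ?thesis
  proof (intro exI[of _ N] allI impI)
    fix f :: "nat set \<Rightarrow> 'p" assume f: "range f \<subseteq> P"
    have "(g \<circ> f) \<in> nsets {..<N} r \<rightarrow> {..<card P}"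
      using f bij_betw_imp_surj_on[OF g] by (auto simp: image_subset_iff)
    then obtain i H where iH: "i < card P" "H \<in> nsets {..<N} m"
      "(g \<circ> f) ` nsets H r \<subseteq> {i}"
      using partn_lstE[OF N] by (metis length_replicate nth_replicate)
    have "i \<in> g ` P" using bij_betw_imp_surj_on[OF g] iH(1) by simp
    then obtain c where c: "c \<in> P" "g c = i" by blast
    have "f S = c" if "S \<subseteq> H" "card S = r" "finite S" for S
    proof -
      have "S \<in> nsets H r" using that by (simp add: nsets_def)
      then have "g (f S) = g c" using iH(3) c by auto
      then show ?thesis using g c f by (auto simp: bij_betw_def inj_on_def)
    qed
    with iH(2) have "H \<subseteq> {..<N} \<and> card H = m \<and> (\<forall>S\<subseteq>H. card S = r \<and> finite S \<longrightarrow> f S = c)"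
      by (auto simp: nsets_def)
    then show "\<exists>H c. H \<subseteq> {..<N} \<and> card H = m \<and>
        (\<forall>S\<subseteq>H. card S = r \<and> finite S \<longrightarrow> f S = c)"
      by blast
  qed
qed

definition corner :: "('i \<Rightarrow> nat) \<Rightarrow> ('i \<Rightarrow> nat) \<Rightarrow> 'i set \<Rightarrow> 'i \<Rightarrow> nat" where
  "corner p q A = (\<lambda>i. if i \<in> A then q i else p i)"

text \<open>
  Each coordinate offers the three values \<open>0, 1, 2\<close>; a subcube is given by two of them, \<open>p i < q i\<close>,
  in each coordinate. The relation \<open>P\<close> is the coincidence pattern that all the subcubes share. Three
  values matter because the middle one is the upper end of one pair and the lower end of another.
\<close>

definition homogeneous_on_cubes :: "'i set \<Rightarrow> (('i \<Rightarrow> nat) \<Rightarrow> 'c) \<Rightarrow> bool" where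
  "homogeneous_on_cubes K G \<longleftrightarrow> (\<exists>P. \<forall>p q A B.
     (\<forall>i. p i < q i \<and> q i \<le> 2) \<longrightarrow> A \<subseteq> K \<longrightarrow> B \<subseteq> K \<longrightarrow>
       (G (corner p q A) = G (corner p q B) \<longleftrightarrow> (A, B) \<in> P))"

text \<open>
  A set of \<open>2k\<close> indices, taken in increasing order as \<open>k\<close> consecutive pairs, determines a cube, and
  the coincidence pattern of the colours on this cube is one of finitely many, whatever the number of
  colours. Ramsey's theorem for \<open>2k\<close>-sets yields a set of \<open>3k\<close> indices all of whose cubes have the
  same pattern; it is cut into \<open>k\<close> consecutive triples. Since the pattern alone is coloured, \<open>N\<close>
  is independent of the type of colours.
\<close>

lemma exists_homogeneous_on_cubes:
  "\<exists>N::nat. \<forall>F :: (nat \<Rightarrow> nat) \<Rightarrow> 'c. \<exists>s. strict_mono_on {..<3*k} s \<and> s ` {..<3*k} \<subseteq> {..<N} \<and>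
     homogeneous_on_cubes {..<k} (\<lambda>v. F (\<lambda>i. if i < k then s (3*i + v i) else 0))"
proof -
  have fin: "finite (Pow (Pow {..<k} \<times> Pow {..<k}))" by simp
  obtain N :: nat where N: "\<forall>f. range f \<subseteq> Pow (Pow {..<k} \<times> Pow {..<k}) \<longrightarrow>
      (\<exists>H c. H \<subseteq> {..<N} \<and> card H = 3*k \<and> (\<forall>S\<subseteq>H. card S = 2*k \<and> finite S \<longrightarrow> f S = c))"
    using Ramsey_finite_colour_type[OF fin] by (rule exE)
  show ?thesis
  proof (intro exI[of _ N] allI)
    fix F :: "(nat \<Rightarrow> nat) \<Rightarrow> 'c"
    define vtx where "vtx e A = (\<lambda>i::nat. if i < k then e (2*i + (if i \<in> A then 1 else 0)) else 0)"
      for e :: "nat \<Rightarrow> nat" and A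
    define pat where "pat S = {(A, B). A \<subseteq> {..<k} \<and> B \<subseteq> {..<k} \<and>
        F (vtx ((!) (sorted_list_of_set S)) A) = F (vtx ((!) (sorted_list_of_set S)) B)}" for S
    have range_pat: "range pat \<subseteq> Pow (Pow {..<k} \<times> Pow {..<k})"
      by (auto simp: pat_def)
    obtain H c where Hc: "H \<subseteq> {..<N} \<and> card H = 3*k \<and>
        (\<forall>S\<subseteq>H. card S = 2*k \<and> finite S \<longrightarrow> pat S = c)"
      using mp[OF spec[OF N, of pat] range_pat] by (elim exE) (rule that)
    have H: "H \<subseteq> {..<N}" "card H = 3*k" using Hc by simp_all
    have c: "pat S = c" if "S \<subseteq> H" "card S = 2*k" "finite S" for S
      using Hc that by simp
    have finH: "finite H" using finite_subset[OF H(1)] by simp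
    define s where "s = (!) (sorted_list_of_set H)"
    have s_mono: "strict_mono_on {..<3*k} s"
      unfolding s_def
      by (rule strict_mono_onI, rule sorted_wrt_nth_less[of "(<)"]) (simp_all add: finH H(2))
    have s_in: "s ` {..<3*k} \<subseteq> H"
    proof (rule image_subsetI)
      fix i assume "i \<in> {..<3*k}"
      then show "s i \<in> H"
        using nth_mem[of i "sorted_list_of_set H"] finH H(2) by (simp add: s_def)
    qed
    have key: "F (\<lambda>i. if i < k then s (3*i + corner p q A i) else 0) =
        F (\<lambda>i. if i < k then s (3*i + corner p q B i) else 0) \<longleftrightarrow> (A, B) \<in> c"
      if pq: "\<forall>i. p i < q i \<and> q i \<le> 2" and AB: "A \<subseteq> {..<k}" "B \<subseteq> {..<k}" for p q A B
    proof -
      \<comment> \<open>\<open>j\<close> lists the positions of the selected pairs in increasing order, so that the chosen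
        subcube is the cube of the \<open>2k\<close>-set \<open>t ` {..<2*k}\<close>.\<close>
      define j where "j n = 3 * (n div 2) + (if even n then p (n div 2) else q (n div 2))" for n
      have "j n < j (Suc n)" for n
      proof (cases "even n")
        case True
        then show ?thesis using pq by (auto simp: j_def)
      next
        case False
        then obtain l where "n = 2*l + 1" by (metis oddE)
        moreover have "q l \<le> 2" using pq by auto
        ultimately show ?thesis by (simp add: j_def)
      qed
      then have j_mono: "strict_mono j" by (simp add: strict_mono_Suc_iff)
      have j_less: "j n < 3*k" if "n < 2*k" for n
      proof -
        have "n div 2 < k" using that by auto
        moreover have "p (n div 2) \<le> 2" "q (n div 2) \<le> 2"
          using pq by (meson less_imp_le order_trans)+
        ultimately show ?thesis by (auto simp: j_def)
      qed
      define t where "t = s \<circ> j"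
      have t_mono: "strict_mono_on {..<2*k} t"
        unfolding t_def
        by (intro strict_mono_onI) (simp add: strict_mono_onD[OF s_mono] strict_monoD[OF j_mono] j_less)
      have img: "t ` {..<2*k} \<subseteq> H"
        using s_in j_less by (auto simp: t_def)
      have "card (t ` {..<2*k}) = 2*k"
        using strict_mono_on_imp_inj_on[OF t_mono] by (simp add: card_image)
      then have "pat (t ` {..<2*k}) = c"
        using c[OF img] by simp
      moreover have "vtx ((!) (sorted_list_of_set (t ` {..<2*k}))) X =
          (\<lambda>i. if i < k then s (3*i + corner p q X i) else 0)" for X
        unfolding sorted_list_of_strict_mono_image[OF t_mono] vtx_def
        by (auto simp: fun_eq_iff t_def j_def corner_def)
      ultimately show ?thesis
        using AB by (auto simp: pat_def)
    qed
    have "homogeneous_on_cubes {..<k} (\<lambda>v. F (\<lambda>i. if i < k then s (3*i + v i) else 0))"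
      unfolding homogeneous_on_cubes_def using key by blast
    then show "\<exists>s. strict_mono_on {..<3*k} s \<and> s ` {..<3*k} \<subseteq> {..<N} \<and>
        homogeneous_on_cubes {..<k} (\<lambda>v. F (\<lambda>i. if i < k then s (3*i + v i) else 0))"
      using s_mono s_in H(1) by blast
  qed
qed

text \<open>
  Call \<open>i\<close> relevant if the corners \<open>{}\<close> and \<open>{i}\<close> have different colours. Homogeneity makes this
  independent of the corner at which \<open>i\<close> is toggled (\<open>toggle\<close>), so irrelevant coordinates
  may be changed freely (\<open>restrict\<close>). Conversely, if two corners of the same colour differ
  in \<open>i\<close>, moving one of them in coordinate \<open>i\<close> within its triple shows that \<open>i\<close> is irrelevant
  (\<open>separate\<close>).
\<close>

lemma homogeneous_imp_canonical:
  fixes G :: "('i \<Rightarrow> nat) \<Rightarrow> 'c"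
  assumes fin: "finite K"
    and hom: "homogeneous_on_cubes K G"
  shows "\<exists>I\<subseteq>K. \<forall>A B. A \<subseteq> K \<longrightarrow> B \<subseteq> K \<longrightarrow>
     (G (corner (\<lambda>_. 0) (\<lambda>_. 1) A) = G (corner (\<lambda>_. 0) (\<lambda>_. 1) B) \<longleftrightarrow> A \<inter> I = B \<inter> I)"
proof -
  define C where "C A = G (corner (\<lambda>_. 0) (\<lambda>_. 1) A)" for A
  obtain P where P: "\<And>p q A B. \<forall>i. p i < q i \<and> q i \<le> 2 \<Longrightarrow> A \<subseteq> K \<Longrightarrow> B \<subseteq> K \<Longrightarrow>
      G (corner p q A) = G (corner p q B) \<longleftrightarrow> (A, B) \<in> P"
    using hom unfolding homogeneous_on_cubes_def by blast
  have pat: "C A = C B \<longleftrightarrow> G (corner p q A) = G (corner p q B)"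
    if "\<forall>i. p i < q i \<and> q i \<le> 2" "A \<subseteq> K" "B \<subseteq> K" for p q A B
    unfolding C_def using that P[of p q A B] P[of "\<lambda>_. 0" "\<lambda>_. 1" A B] by simp
  define I where "I = {i\<in>K. C {} \<noteq> C {i}}"
  have toggle_other: "C A = C (insert i A) \<longleftrightarrow> C (insert j A) = C (insert i (insert j A))"
    if "i \<in> K" "j \<in> K" "i \<noteq> j" "j \<notin> A" "A \<subseteq> K" for i j A
  proof -
    \<comment> \<open>With the value \<open>1\<close> in coordinate \<open>j\<close>, the point is a lower corner for the pair \<open>(1, 2)\<close> and an
      upper corner for the pair \<open>(0, 1)\<close>.\<close>
    define p q where "p = (\<lambda>l. if l = j then 1 else 0 :: nat)"
      and "q = (\<lambda>l. if l = j then 2 else 1 :: nat)"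
    have "C A = C (insert i A) \<longleftrightarrow> G (corner p q A) = G (corner p q (insert i A))"
      using that by (intro pat) (auto simp: p_def q_def)
    also have "corner p q A = corner (\<lambda>_. 0) (\<lambda>_. 1) (insert j A)"
      using that by (auto simp: corner_def p_def q_def fun_eq_iff)
    also have "corner p q (insert i A) = corner (\<lambda>_. 0) (\<lambda>_. 1) (insert i (insert j A))"
      using that by (auto simp: corner_def p_def q_def fun_eq_iff)
    finally show ?thesis unfolding C_def .
  qed
  have toggle: "C A = C (insert i A) \<longleftrightarrow> i \<notin> I" if "A \<subseteq> K" "i \<in> K" "i \<notin> A" for A i
  proof -
    have "finite A" using that(1) fin finite_subset by blast
    then show ?thesis using that
    proof (induction A rule: finite_induct)
      case empty
      then show ?case by (simp add: I_def)
    next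
      case (insert j A)
      then show ?case using toggle_other[of i j A] by auto
    qed
  qed
  have separate: "i \<notin> I" if "C A = C B" "A \<subseteq> K" "B \<subseteq> K" "i \<in> A" "i \<notin> B" for A B i
  proof -
    \<comment> \<open>The corner of \<open>B\<close> has the value \<open>0\<close> in coordinate \<open>i\<close>. The pairs \<open>(0, 1)\<close> and \<open>(0, 2)\<close> give it
      the same colour as the corner of \<open>A\<close> with the value \<open>1\<close> and with the value \<open>2\<close>; so the
      latter two agree, and the pair \<open>(1, 2)\<close> compares \<open>A\<close> with \<open>A - {i}\<close>.\<close>
    define q where "q = (\<lambda>l. if l = i then 2 else 1 :: nat)"
    define p where "p = (\<lambda>l. if l = i then 1 else 0 :: nat)"
    have "C A = G (corner (\<lambda>_. 0) (\<lambda>_. 1) B)"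
      using that by (simp add: C_def)
    also have "corner (\<lambda>_. 0) (\<lambda>_. 1) B = corner (\<lambda>_. 0) q B"
      using that by (auto simp: corner_def q_def fun_eq_iff)
    also have "G \<dots> = G (corner (\<lambda>_. 0) q A)"
      using pat[of "\<lambda>_. 0" q A B] that by (auto simp: q_def)
    also have "corner (\<lambda>_. 0) q A = corner p q A"
      using that by (auto simp: corner_def p_def fun_eq_iff)
    finally have "G (corner p q A) = C A" by simp
    also have "C A = G (corner p q (A - {i}))"
      unfolding C_def by (rule arg_cong[of _ _ G])
        (use that in \<open>auto simp: corner_def p_def q_def fun_eq_iff\<close>)
    finally have "G (corner p q A) = G (corner p q (A - {i}))" .
    moreover have "A - {i} \<subseteq> K" using that by blast
    ultimately have "C A = C (A - {i})"
      using pat[of p q A "A - {i}"] that by (simp add: p_def q_def)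
    then show ?thesis
      using toggle[of "A - {i}" i] that by (auto simp: insert_absorb)
  qed
  have restrict: "C A = C (A \<inter> I)" if "A \<subseteq> K" for A
  proof -
    have "C ((A \<inter> I) \<union> D) = C (A \<inter> I)" if "D \<subseteq> A - I" for D
    proof -
      have "finite D" using that \<open>A \<subseteq> K\<close> fin by (meson Diff_subset finite_subset order_trans)
      then show ?thesis using that
      proof (induction D rule: finite_induct)
        case (insert d D)
        then have "(A \<inter> I) \<union> D \<subseteq> K" "d \<in> K" "d \<notin> (A \<inter> I) \<union> D" "d \<notin> I"
          using \<open>A \<subseteq> K\<close> by auto
        then show ?case using toggle[of "(A \<inter> I) \<union> D" d] insert by simp
      qed simp
    qed
    from this[of "A - I"] show ?thesis by (simp add: Int_Diff_Un)
  qed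
  have "C A = C B \<longleftrightarrow> A \<inter> I = B \<inter> I" if "A \<subseteq> K" "B \<subseteq> K" for A B
  proof
    assume "C A = C B"
    then show "A \<inter> I = B \<inter> I" using separate[of A B] separate[of B A] that by auto
  qed (use restrict that in metis)
  moreover have "I \<subseteq> K" by (auto simp: I_def)
  ultimately show ?thesis unfolding C_def by blast
qed

text \<open>
  The value \<open>0\<close> beyond the \<open>k\<close> coordinates only makes a vertex a total function determined by its
  first \<open>k\<close> values.
\<close>

definition cube_vertex :: "nat \<Rightarrow> (nat \<Rightarrow> nat) \<Rightarrow> (nat \<Rightarrow> nat) \<Rightarrow> nat set \<Rightarrow> nat \<Rightarrow> nat" where
  "cube_vertex k l h A = (\<lambda>i. if i < k then (if i \<in> A then h i else l i) else 0)"

text \<open>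
  All \<open>2k\<close> values are distinct, also for different coordinates: the points assigned to the vertices
  use the values as indices of coordinate axes.
\<close>

definition is_cube :: "nat \<Rightarrow> nat \<Rightarrow> (nat \<Rightarrow> nat) \<Rightarrow> (nat \<Rightarrow> nat) \<Rightarrow> bool" where
  "is_cube k N l h \<longleftrightarrow> inj_on l {..<k} \<and> inj_on h {..<k} \<and>
     l ` {..<k} \<inter> h ` {..<k} = {} \<and> l ` {..<k} \<union> h ` {..<k} \<subseteq> {..<N}"

text \<open>
  The size \<open>N\<close> does not depend on the colouring, nor on how many colours it uses; this is what makes
  the dimension in the final result independent of \<open>r\<close>.
\<close>

theorem canonical_cube:
  "\<exists>N::nat. \<forall>F :: (nat \<Rightarrow> nat) \<Rightarrow> 'c. \<exists>l h I.
     is_cube k N l h \<and>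
     (\<forall>A B. A \<subseteq> {..<k} \<longrightarrow> B \<subseteq> {..<k} \<longrightarrow>
        (F (cube_vertex k l h A) = F (cube_vertex k l h B) \<longleftrightarrow> A \<inter> I = B \<inter> I))"
proof -
  obtain N :: nat where N: "\<forall>F :: (nat \<Rightarrow> nat) \<Rightarrow> 'c. \<exists>s.
     strict_mono_on {..<3*k} s \<and> s ` {..<3*k} \<subseteq> {..<N} \<and>
     homogeneous_on_cubes {..<k} (\<lambda>v. F (\<lambda>i. if i < k then s (3*i + v i) else 0))"
    using exists_homogeneous_on_cubes[of k, where 'c = 'c] by blast
  show ?thesis
  proof (intro exI[of _ N] allI)
    fix F :: "(nat \<Rightarrow> nat) \<Rightarrow> 'c"
    obtain s where s: "strict_mono_on {..<3*k} s" "s ` {..<3*k} \<subseteq> {..<N}"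
      and hom: "homogeneous_on_cubes {..<k} (\<lambda>v. F (\<lambda>i. if i < k then s (3*i + v i) else 0))"
      using N[rule_format, of F] by blast
    define G where "G v = F (\<lambda>i. if i < k then s (3*i + v i) else 0)" for v
    obtain I where I: "\<forall>A B. A \<subseteq> {..<k} \<longrightarrow> B \<subseteq> {..<k} \<longrightarrow>
        (G (corner (\<lambda>_. 0) (\<lambda>_. 1) A) = G (corner (\<lambda>_. 0) (\<lambda>_. 1) B) \<longleftrightarrow> A \<inter> I = B \<inter> I)"
      using homogeneous_imp_canonical[OF finite_lessThan hom] unfolding G_def by blast
    define l h where "l i = s (3*i)" and "h i = s (3*i + 1)" for i
    have inj: "inj_on s {..<3*k}" using s(1) by (rule strict_mono_on_imp_inj_on)
    have s_eq: "s a = s b \<longleftrightarrow> a = b" if "a < 3*k" "b < 3*k" for a b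
      using inj that by (auto dest: inj_onD)
    have vertex: "F (cube_vertex k l h A) = G (corner (\<lambda>_. 0) (\<lambda>_. 1) A)" for A
      unfolding G_def corner_def cube_vertex_def l_def h_def
      by (rule arg_cong[of _ _ F]) (auto simp: fun_eq_iff)
    have "inj_on l {..<k}" "inj_on h {..<k}"
      by (auto intro!: inj_onI simp: l_def h_def s_eq)
    moreover have "l i \<noteq> h j" if "i < k" "j < k" for i j
      using that s_eq[of "3*i" "3*j+1"] by (auto simp: l_def h_def) presburger
    then have "l ` {..<k} \<inter> h ` {..<k} = {}" by auto
    moreover have "l ` {..<k} \<union> h ` {..<k} \<subseteq> {..<N}"
      using s(2) by (auto simp: l_def h_def image_subset_iff)
    ultimately have "is_cube k N l h" by (simp add: is_cube_def)
    then show "\<exists>l h I. is_cube k N l h \<and>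
       (\<forall>A B. A \<subseteq> {..<k} \<longrightarrow> B \<subseteq> {..<k} \<longrightarrow>
        (F (cube_vertex k l h A) = F (cube_vertex k l h B) \<longleftrightarrow> A \<inter> I = B \<inter> I))"
      using I by (intro exI[of _ l] exI[of _ h] exI[of _ I] conjI) (simp_all only: vertex)
  qed
qed

section \<open>Weighted cubes in Euclidean space\<close>

definition weighted_point :: "nat \<Rightarrow> (nat \<Rightarrow> real) \<Rightarrow> (nat \<Rightarrow> nat) \<Rightarrow> nat \<Rightarrow> real" where
  "weighted_point k w x = (\<lambda>c. \<Sum>i<k. if x i = c then w i else 0)"

lemma weighted_point_in_Euclidean:
  assumes "\<And>i. i < k \<Longrightarrow> x i < n"
  shows "weighted_point k w x \<in> euclidean_points n"
  using assms by (force simp: topspace_Euclidean_space weighted_point_def intro!: sum.neutral)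

text \<open>
  A coordinate \<open>i\<close> in which the vertices differ moves the weight \<open>w i\<close> from one axis to another, and
  the axes of different coordinates are disjoint; so it contributes \<open>2 * (w i)\<^sup>2\<close>.
\<close>

lemma edist_cube_vertices:
  assumes cube: "is_cube k n l h"
    and AB: "A \<subseteq> {..<k}" "B \<subseteq> {..<k}"
  shows "edist n (weighted_point k w (cube_vertex k l h A)) (weighted_point k w (cube_vertex k l h B))
       = sqrt (\<Sum>i \<in> (A - B) \<union> (B - A). 2 * (w i)\<^sup>2)"
proof -
  have lh: "inj_on l {..<k}" "inj_on h {..<k}" "l ` {..<k} \<inter> h ` {..<k} = {}"
      "l ` {..<k} \<union> h ` {..<k} \<subseteq> {..<n}"
    using cube by (auto simp: is_cube_def)
  let ?X = "\<lambda>A. weighted_point k w (cube_vertex k l h A)"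
  define g where "g c = (?X A c - ?X B c)\<^sup>2" for c
  have at_l: "?X A (l j) = (if j \<in> A then 0 else w j)" if "j < k" for j A
  proof -
    have "?X A (l j) = (\<Sum>i<k. if i = j then (if j \<in> A then 0 else w j) else 0)"
      unfolding weighted_point_def using lh(1,3) that
      by (intro sum.cong) (auto simp: cube_vertex_def inj_on_def)
    then show ?thesis using that by simp
  qed
  have at_h: "?X A (h j) = (if j \<in> A then w j else 0)" if "j < k" for j A
  proof -
    have "?X A (h j) = (\<Sum>i<k. if i = j then (if j \<in> A then w j else 0) else 0)"
      unfolding weighted_point_def using lh(2,3) that
      by (intro sum.cong) (auto simp: cube_vertex_def inj_on_def)
    then show ?thesis using that by simp
  qed
  have elsewhere: "?X A c = 0" if "c \<notin> l ` {..<k} \<union> h ` {..<k}" for c A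
    using that unfolding weighted_point_def by (auto intro!: sum.neutral simp: cube_vertex_def)
  have "(\<Sum>c<n. g c) = (\<Sum>c \<in> l ` {..<k} \<union> h ` {..<k}. g c)"
    using lh(4) elsewhere by (intro sum.mono_neutral_right) (auto simp: g_def)
  also have "\<dots> = (\<Sum>i<k. g (l i)) + (\<Sum>i<k. g (h i))"
    using lh(1-3) by (simp add: sum.union_disjoint sum.reindex)
  also have "\<dots> = (\<Sum>i<k. if i \<in> (A - B) \<union> (B - A) then 2 * (w i)\<^sup>2 else 0)"
    unfolding sum.distrib[symmetric] by (intro sum.cong) (auto simp: g_def at_l at_h)
  also have "\<dots> = (\<Sum>i \<in> (A - B) \<union> (B - A). 2 * (w i)\<^sup>2)"
    using AB by (intro sum.mono_neutral_cong_right) auto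
  finally show ?thesis
    by (simp add: edist_def L2_set_def g_def)
qed

lemma edist_commute: "edist n x y = edist n y x"
  by (simp add: edist_def L2_set_def power2_commute)

lemma congruent_copy_of_rectangle:
  fixes p u v :: "'a::euclidean_space"
  assumes uv: "u \<noteq> 0" "v \<noteq> 0" "u \<bullet> v = 0"
    and R: "R = {p, p + u, p + u + v, p + v}"
    and X: "{X0, X1, X2, X3} \<subseteq> euclidean_points n"
    and sides: "edist n X0 X1 = norm u" "edist n X3 X2 = norm u"
      "edist n X0 X3 = norm v" "edist n X1 X2 = norm v"
    and diagonals: "edist n X0 X2 = sqrt ((norm u)\<^sup>2 + (norm v)\<^sup>2)"
      "edist n X1 X3 = sqrt ((norm u)\<^sup>2 + (norm v)\<^sup>2)"
  shows "congruent_copy n R {X0, X1, X2, X3}"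
proof -
  have vu: "v \<bullet> u = 0" using uv(3) by (simp add: inner_commute)
  have "u \<noteq> v" using uv by auto
  moreover have "u + v \<noteq> 0"
  proof
    assume "u + v = 0"
    then have "u \<bullet> (u + v) = 0" by simp
    then show False using uv by (simp add: inner_add_right)
  qed
  ultimately have distinct: "p \<noteq> p + u" "p \<noteq> p + u + v" "p \<noteq> p + v" "p + u \<noteq> p + u + v"
      "p + u \<noteq> p + v" "p + u + v \<noteq> p + v"
    using uv by (auto simp: add.assoc)
  have diag: "norm (u + v) = sqrt ((norm u)\<^sup>2 + (norm v)\<^sup>2)"
      "norm (u - v) = sqrt ((norm u)\<^sup>2 + (norm v)\<^sup>2)"
    using uv(3) vu by (simp_all add: norm_eq_sqrt_inner inner_simps)
  have dists: "dist p (p + u) = norm u" "dist (p + v) (p + u + v) = norm u"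
      "dist p (p + v) = norm v" "dist (p + u) (p + u + v) = norm v"
      "dist p (p + u + v) = sqrt ((norm u)\<^sup>2 + (norm v)\<^sup>2)"
      "dist (p + u) (p + v) = sqrt ((norm u)\<^sup>2 + (norm v)\<^sup>2)"
    using diag by (simp_all add: dist_norm norm_minus_commute algebra_simps)
  have self: "edist n x x = 0" for x by (simp add: edist_def L2_set_def)
  define f where "f x = (if x = p then X0 else if x = p + u then X1
      else if x = p + u + v then X2 else X3)" for x
  have f: "f p = X0" "f (p + u) = X1" "f (p + u + v) = X2" "f (p + v) = X3"
    using distinct by (simp_all add: f_def)
  show ?thesis
    unfolding congruent_copy_def
  proof (intro exI[of _ f] conjI)
    show "f ` R = {X0, X1, X2, X3}" by (simp add: R f)
    show "{X0, X1, X2, X3} \<subseteq> euclidean_points n" by fact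
    show "\<forall>x\<in>R. \<forall>y\<in>R. edist n (f x) (f y) = dist x y"
      unfolding R ball_simps
      by (simp only: f self dists sides diagonals dist_self simp_thms
          edist_commute[of n X1 X0] edist_commute[of n X2 X0] edist_commute[of n X3 X0]
          edist_commute[of n X2 X1] edist_commute[of n X3 X1] edist_commute[of n X2 X3]
          dist_commute[of "p + u" p] dist_commute[of "p + u + v" p] dist_commute[of "p + v" p]
          dist_commute[of "p + u + v" "p + u"] dist_commute[of "p + v" "p + u"]
          dist_commute[of "p + u + v" "p + v"])
  qed
qed

section \<open>Weights that serve every set of relevant coordinates\<close>

text \<open>
  The list of values \<open>q i\<close> consists of \<open>m + 1\<close> copies of \<open>d = a / m \<le> b\<close>, two copies of \<open>b\<close>, and the
  complements \<open>a - b\<close> and \<open>b - d\<close>. If two copies of \<open>d\<close> are relevant, one of them is used in \<open>U\<close>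
  among \<open>m\<close> copies of \<open>d\<close>, and the other in \<open>V\<close> together with \<open>b - d\<close>. Otherwise \<open>m\<close> irrelevant
  copies of \<open>d\<close> are available for \<open>U\<close>, and \<open>V\<close> is an irrelevant copy of \<open>b\<close> if there is one. If
  both copies of \<open>b\<close> are relevant, one is used in \<open>U\<close> together with \<open>a - b\<close>, and the other is \<open>V\<close>.
  The complements may be zero; a coordinate with \<open>q i = 0\<close> does not move the point.
\<close>

lemma universal_weights:
  fixes a b :: real
  assumes "0 < b" "b \<le> a"
  shows "\<exists>k. \<exists>q :: nat \<Rightarrow> real. (\<forall>i. 0 \<le> q i) \<and>
     (\<forall>I. \<exists>U V. U \<subseteq> {..<k} \<and> V \<subseteq> {..<k} \<and> U \<inter> V = {} \<and> sum q U = a \<and> sum q V = b \<and>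
        (U \<inter> I = {} \<longleftrightarrow> V \<inter> I = {}))"
proof -
  define m where "m = nat \<lceil>a / b\<rceil>"
  have m_pos: "m > 0" using assms by (simp add: m_def)
  have "a / b \<le> m" unfolding m_def by (rule real_nat_ceiling_ge)
  define d where "d = a / m"
  have d: "m * d = a" "0 \<le> d" "d \<le> b"
    using m_pos assms \<open>a / b \<le> m\<close> by (auto simp: d_def field_simps)
  define q where "q i = (if i \<le> m then d else if i \<le> m + 2 then b
      else if i = m + 3 then a - b else b - d)" for i
  have nonneg: "0 \<le> q i" for i using assms d by (auto simp: q_def)
  have sum_d: "sum q ({..m} - {z}) = a" if "z \<le> m" for z
  proof -
    have "sum q ({..m} - {z}) = (\<Sum>i \<in> {..m} - {z}. d)"
      by (intro sum.cong) (auto simp: q_def)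
    then show ?thesis using that d(1) by simp
  qed
  have "\<exists>U V. U \<subseteq> {..<m+5} \<and> V \<subseteq> {..<m+5} \<and> U \<inter> V = {} \<and> sum q U = a \<and> sum q V = b \<and>
        (U \<inter> I = {} \<longleftrightarrow> V \<inter> I = {})" for I
  proof (cases "\<exists>x y. x \<le> m \<and> y \<le> m \<and> x \<noteq> y \<and> x \<in> I \<and> y \<in> I")
    case True
    then obtain x y where xy: "x \<le> m" "y \<le> m" "x \<noteq> y" "x \<in> I" "y \<in> I" by blast
    have "sum q {y, m+4} = b" using xy by (simp add: q_def)
    moreover have "{..m} - {y} \<subseteq> {..<m+5}" "{y, m+4} \<subseteq> {..<m+5}"
      "({..m} - {y}) \<inter> {y, m+4} = {}" using xy by auto
    moreover have "x \<in> ({..m} - {y}) \<inter> I" "y \<in> {y, m+4} \<inter> I" using xy by auto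
    ultimately show ?thesis using sum_d[OF xy(2)] by blast
  next
    case False
    then obtain z where z: "z \<le> m" "({..m} - {z}) \<inter> I = {}"
      by (cases "{..m} \<inter> I = {}") auto
    show ?thesis
    proof (cases "m+1 \<in> I \<and> m+2 \<in> I")
      case True
      have "sum q {m+1, m+3} = a" "sum q {m+2} = b" by (simp_all add: q_def)
      moreover have "{m+1, m+3} \<subseteq> {..<m+5}" "{m+2} \<subseteq> {..<m+5}" "{m+1, m+3} \<inter> {m+2} = {}"
        by auto
      moreover have "m+1 \<in> {m+1, m+3} \<inter> I" "m+2 \<in> {m+2} \<inter> I" using True by auto
      ultimately show ?thesis by blast
    next
      case False
      then obtain y where y: "y = m+1 \<or> y = m+2" "y \<notin> I" by blast
      have "sum q {y} = b" using y by (auto simp: q_def)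
      moreover have "{..m} - {z} \<subseteq> {..<m+5}" "{y} \<subseteq> {..<m+5}" "({..m} - {z}) \<inter> {y} = {}"
        using y by auto
      moreover have "{y} \<inter> I = {}" using y by auto
      ultimately show ?thesis using sum_d[OF z(1)] z(2) by blast
    qed
  qed
  then show ?thesis using nonneg by blast
qed

section \<open>Monochromatic or rainbow rectangles\<close>

text \<open>
  The number \<open>k\<close> of coordinates is determined by the side lengths, and the dimension by \<open>k\<close>, before
  the colouring enters.
\<close>

lemma Gallai_Ramsey_rectangle:
  fixes p u v :: "'a::euclidean_space"
  assumes uv: "u \<noteq> 0" "v \<noteq> 0" "u \<bullet> v = 0" and le: "norm v \<le> norm u"
    and R: "R = {p, p + u, p + u + v, p + v}"
  shows "\<exists>n0::nat. \<forall>r n. n \<ge> n0 \<longrightarrow> gallai_ramsey n r R R"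
proof -
  obtain k and q :: "nat \<Rightarrow> real" where q0: "\<And>i. 0 \<le> q i"
    and q: "\<And>I. \<exists>U V. U \<subseteq> {..<k} \<and> V \<subseteq> {..<k} \<and> U \<inter> V = {} \<and>
        sum q U = (norm u)\<^sup>2 \<and> sum q V = (norm v)\<^sup>2 \<and> (U \<inter> I = {} \<longleftrightarrow> V \<inter> I = {})"
    using universal_weights[of "(norm v)\<^sup>2" "(norm u)\<^sup>2"] uv le
    by (metis norm_ge_zero power_mono zero_less_norm_iff zero_less_power)
  define w where "w i = sqrt (q i / 2)" for i
  have w: "2 * (w i)\<^sup>2 = q i" for i using q0 by (simp add: w_def)
  obtain N :: nat where N: "\<forall>F :: (nat \<Rightarrow> nat) \<Rightarrow> nat. \<exists>l h I.
     is_cube k N l h \<and>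
     (\<forall>A B. A \<subseteq> {..<k} \<longrightarrow> B \<subseteq> {..<k} \<longrightarrow>
        (F (cube_vertex k l h A) = F (cube_vertex k l h B) \<longleftrightarrow> A \<inter> I = B \<inter> I))"
    using canonical_cube[of k, where 'c = nat] by (rule exE)
  have "gallai_ramsey n r R R" if "N \<le> n" for n r
    unfolding gallai_ramsey_def
  proof (intro allI impI)
    fix col :: "(nat \<Rightarrow> real) \<Rightarrow> nat"
    obtain l h I where cube: "is_cube k N l h \<and> (\<forall>A B. A \<subseteq> {..<k} \<longrightarrow> B \<subseteq> {..<k} \<longrightarrow>
        (col (weighted_point k w (cube_vertex k l h A)) =
         col (weighted_point k w (cube_vertex k l h B)) \<longleftrightarrow> A \<inter> I = B \<inter> I))"
      using spec[OF N, of "\<lambda>x. col (weighted_point k w x)"] by (elim exE) (rule that)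
    then have lh: "is_cube k n l h" using that unfolding is_cube_def by fastforce
    define X where "X A = weighted_point k w (cube_vertex k l h A)" for A
    have X_in: "X A \<in> euclidean_points n" for A
      unfolding X_def using lh
      by (intro weighted_point_in_Euclidean) (auto simp: cube_vertex_def is_cube_def)
    have X_dist: "edist n (X A) (X B) = sqrt (sum q ((A - B) \<union> (B - A)))"
      if "A \<subseteq> {..<k}" "B \<subseteq> {..<k}" for A B
      unfolding X_def edist_cube_vertices[OF lh that] w ..
    have X_col: "col (X A) = col (X B) \<longleftrightarrow> A \<inter> I = B \<inter> I"
      if "A \<subseteq> {..<k}" "B \<subseteq> {..<k}" for A B
      unfolding X_def using cube that by simp
    obtain U V where UV: "U \<subseteq> {..<k}" "V \<subseteq> {..<k}" "U \<inter> V = {}"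
        "sum q U = (norm u)\<^sup>2" "sum q V = (norm v)\<^sup>2" "U \<inter> I = {} \<longleftrightarrow> V \<inter> I = {}"
      using q[of I] by blast
    have fin: "finite U" "finite V" using UV(1,2) finite_subset by auto
    have sum_UV: "sum q (U \<union> V) = (norm u)\<^sup>2 + (norm v)\<^sup>2"
      using UV(3-5) fin by (simp add: sum.union_disjoint)
    have disj: "U - V = U" "V - U = V" "V \<inter> U = {}" using UV(3) by auto
    have within: "V - (U \<union> V) = {}" "U - (U \<union> V) = {}" by blast+
    let ?S = "{X {}, X U, X (U \<union> V), X V}"
    have copy: "congruent_copy n R ?S"
    proof (rule congruent_copy_of_rectangle[OF uv R])
      show "?S \<subseteq> euclidean_points n" using X_in by simp
    qed (use UV(1,2,4,5) sum_UV disj in \<open>auto simp: X_dist Un_Diff within\<close>)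
    show "(\<exists>S. congruent_copy n R S \<and> Defs.monochromatic col S) \<or>
        (\<exists>S. congruent_copy n R S \<and> rainbow col S)"
    proof (cases "U \<inter> I = {}")
      case True
      then have "Defs.monochromatic col ?S"
        using UV by (auto simp: Defs.monochromatic_def X_col Int_Un_distrib2)
      then show ?thesis using copy by blast
    next
      case False
      with UV obtain i j where "i \<in> U \<inter> I" "j \<in> V \<inter> I" by blast
      moreover have "i \<notin> V" "j \<notin> U" using calculation UV(3) by auto
      ultimately have "{} \<inter> I \<noteq> U \<inter> I" "{} \<inter> I \<noteq> V \<inter> I" "{} \<inter> I \<noteq> (U \<union> V) \<inter> I"
          "U \<inter> I \<noteq> V \<inter> I" "U \<inter> I \<noteq> (U \<union> V) \<inter> I" "V \<inter> I \<noteq> (U \<union> V) \<inter> I"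
        by blast+
      then have "rainbow col ?S"
        using UV(1,2) by (auto simp: rainbow_def X_col)
      then show ?thesis using copy by blast
    qed
  qed
  then show ?thesis by blast
qed

theorem theorem1p3:
  fixes R :: "'a::euclidean_space set"
  assumes "is_rectangle R"
  shows "\<exists>n0::nat. \<forall>r::nat. \<forall>n::nat. r \<ge> 1 \<longrightarrow> n \<ge> n0 \<longrightarrow> gallai_ramsey n r R R"
proof -
  obtain p u v where uv: "u \<noteq> 0" "v \<noteq> 0" "u \<bullet> v = 0" and R: "R = {p, p + u, p + u + v, p + v}"
    using assms unfolding is_rectangle_def by blast
  have swap: "R = {p, p + v, p + v + u, p + u}" "v \<bullet> u = 0"
    using R uv(3) by (auto simp: ac_simps inner_commute)
  show ?thesis
  proof (cases "norm v \<le> norm u")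
    case True
    then show ?thesis using Gallai_Ramsey_rectangle[OF uv _ R] by blast
  next
    case False
    then have "norm u \<le> norm v" by simp
    then show ?thesis using Gallai_Ramsey_rectangle[OF uv(2,1) swap(2) _ swap(1)] by blast
  qed
qed

end
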